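(* Assume the perturbation coefficient $p$ is sufficiently small, that is, $p\to 0$. When the network structure is changed from $\mathbf{W}$ to $\tilde{\mathbf{W}}=\mathbf{W}+p\,\mathbf{\Delta}_W$, the total opinion with perturbation, $\tilde f=\mathbf{1}^T\tilde{\mathbf{B}}\mathbf{A}\mathbf{s}$ with $\tilde{\mathbf{B}}=(\mathbf{I}-(\mathbf{I}-\mathbf{A})\tilde{\mathbf{W}})^{-1}$, can be approximated as $$\tilde f\approx\mathbf{1}^T\mathbf{B}\mathbf{A}\mathbf{s}+p\cdot\mathbf{1}^T\mathbf{B}(\mathbf{I}-\mathbf{A})\mathbf{\Delta}_W\mathbf{B}\mathbf{A}\mathbf{s}.$$
   Context: There are $n$ users $\mathcal{V}=\{1,\dots,n\}$. $\mathbf{W}\in\mathbb{R}^{n\times n}$ is entrywise nonnegative with $\mathbf{W}\mathbf{1}=\mathbf{1}$, where $\mathbf{1}$ is the all-ones vector. $\mathbf{A}=\mathrm{Diag}(\alpha_1,\dots,\alpha_n)$ with $0<\alpha_i<1$ (stubbornness values), and $\mathbf{s}\in\mathbb{R}^n$ is the vector of internal opinions. $\mathbf{I}$ is the identity matrix and $\mathbf{B}=[\mathbf{I}-(\mathbf{I}-\mathbf{A})\mathbf{W}]^{-1}$. The total opinion without perturbation is $f=\mathbf{1}^T\mathbf{B}\mathbf{A}\mathbf{s}$. Perturbation: given a set of attackers $\mathcal{A}\subseteq\mathcal{V}$ and, for each $u\in\mathcal{A}$, a set of target users $\mathcal{T}_u\subseteq\mathcal{V}$, let $\mathcal{T}=\bigcup_{u\in\mathcal{A}}\mathcal{T}_u$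 and, for $v\in\mathcal{T}$, let $\mathcal{A}_v=\{u\in\mathcal{A}: v\in\mathcal{T}_u\}$ be the attackers influencing $v$. With $\mathbf{e}_i$ the $i$-th standard basis vector, $$\mathbf{\Delta}_W=\sum_{v\in\mathcal{T}}\mathbf{e}_v\sum_{u\in\mathcal{A}_v}\mathbf{e}_u^T-\sum_{v\in\mathcal{T}}|\mathcal{A}_v|\,\mathbf{e}_v\mathbf{e}_v^T\mathbf{W}.$$ The perturbation coefficient $p$ is the weight with which each attacker influences each of its target users; it satisfies $|\mathcal{A}_v|\,p\le 1$ for all $v\in\mathcal{T}$. *)

theory Defs
  imports "HOL-Analysis.Analysis" "HOL-Library.Landau_Symbols"
begin

definition ones :: "real ^ 'n" where
  "ones = (\<chi> i. 1)"

definition diag :: "real ^ 'n \<Rightarrow> real ^ 'n ^ 'n" where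
  "diag a = (\<chi> i j. if i = j then a $ i else 0)"

text \<open>The outer product x y^T of two column vectors.\<close>

definition outer :: "real ^ 'n \<Rightarrow> real ^ 'n \<Rightarrow> real ^ 'n ^ 'n" where
  "outer x y = (\<chi> i j. x $ i * y $ j)"

text \<open>
  The matrix I - (I - A) W of the opinion dynamics, with A = diag \<open>\<alpha>\<close>.
  The identity matrix is \<open>mat 1\<close>; the numeral \<open>1\<close> at a matrix type would be the
  all-ones matrix.
\<close>

definition system_matrix :: "real ^ 'n \<Rightarrow> real ^ 'n ^ 'n \<Rightarrow> real ^ 'n ^ 'n" where
  "system_matrix \<alpha> W = mat 1 - (mat 1 - diag \<alpha>) ** W"

text \<open>
  The matrix B. Since \<open>matrix_inv\<close> is unspecified on singular matrices, this is the
  inverse only when \<open>system_matrix \<alpha> W\<close> is invertible.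
\<close>

definition opinion_matrix :: "real ^ 'n \<Rightarrow> real ^ 'n ^ 'n \<Rightarrow> real ^ 'n ^ 'n" where
  "opinion_matrix \<alpha> W = matrix_inv (system_matrix \<alpha> W)"

definition total_opinion :: "real ^ 'n \<Rightarrow> real ^ 'n \<Rightarrow> real ^ 'n ^ 'n \<Rightarrow> real" where
  "total_opinion \<alpha> s W = ones \<bullet> ((opinion_matrix \<alpha> W ** diag \<alpha>) *v s)"

text \<open>\<open>Att\<close> is the set of attackers and \<open>Tgt u\<close> the set of target users of the attacker \<open>u\<close>.\<close>

definition all_targets :: "'n set \<Rightarrow> ('n \<Rightarrow> 'n set) \<Rightarrow> 'n set" where
  "all_targets Att Tgt = (\<Union>u\<in>Att. Tgt u)"

definition attackers_of :: "'n set \<Rightarrow> ('n \<Rightarrow> 'n set) \<Rightarrow> 'n \<Rightarrow> 'n set" where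
  "attackers_of Att Tgt v = {u \<in> Att. v \<in> Tgt u}"

definition Delta_W ::
    "'n set \<Rightarrow> ('n \<Rightarrow> 'n set) \<Rightarrow> real ^ 'n ^ 'n \<Rightarrow> real ^ 'n ^ 'n" where
  "Delta_W Att Tgt W =
     (\<Sum>v\<in>all_targets Att Tgt. outer (axis v 1) (\<Sum>u\<in>attackers_of Att Tgt v. axis u 1))
   - (\<Sum>v\<in>all_targets Att Tgt.
        real (card (attackers_of Att Tgt v)) *\<^sub>R (outer (axis v 1) (axis v 1) ** W))"

text \<open>
  The perturbation coefficients: nonnegative, being weights, and such that the total
  weight given to the attackers of any target is at most one.
\<close>

definition admissible_coeffs :: "'n set \<Rightarrow> ('n \<Rightarrow> 'n set) \<Rightarrow> real set" where
  "admissible_coeffs Att Tgt =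
     {p. 0 \<le> p \<and> (\<forall>v\<in>all_targets Att Tgt. real (card (attackers_of Att Tgt v)) * p \<le> 1)}"

definition perturbed ::
    "'n set \<Rightarrow> ('n \<Rightarrow> 'n set) \<Rightarrow> real ^ 'n ^ 'n \<Rightarrow> real \<Rightarrow> real ^ 'n ^ 'n" where
  "perturbed Att Tgt W p = W + p *\<^sub>R Delta_W Att Tgt W"

end

theory Submission imports Defs begin

text \<open>
  With \<open>D = (I - A) \<Delta>\<close>, the perturbed system matrix is \<open>M\<^sub>p = M - p D\<close>, so the resolvent
  identity, applied twice, expands the perturbed inverse as
  \<open>B\<^sub>p = B + p B D B + p\<^sup>2 B\<^sub>p D B D B\<close>. The remainder is quadratic in \<open>p\<close> because \<open>B\<^sub>p\<close> is
  bounded uniformly in the maximum norm: the perturbed weights remain row-stochastic, and if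
  \<open>i\<close> is a coordinate where \<open>\<bar>z $ i\<bar>\<close> is largest, then \<open>\<alpha>\<^sub>i \<bar>z $ i\<bar> \<le> \<bar>(M\<^sub>p z) $ i\<bar>\<close>.
\<close>

text \<open>The property shared by \<open>W\<close> and all its admissible perturbations, so that
  one estimate serves them all.\<close>

definition row_stochastic :: "real ^ 'n ^ 'n \<Rightarrow> bool" where
  "row_stochastic P \<longleftrightarrow> (\<forall>i j. 0 \<le> P $ i $ j) \<and> P *v ones = ones"

lemma row_sum_stochastic:
  assumes "row_stochastic P"
  shows "(\<Sum>j\<in>UNIV. P $ i $ j) = 1"
proof -
  have "(P *v ones) $ i = ones $ i"
    using assms by (simp add: row_stochastic_def)
  then show ?thesis
    by (simp add: matrix_vector_mult_def ones_def)
qed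

lemma diag_mult_component: "(diag a ** P) $ i $ j = a $ i * P $ i $ j"
  by (simp add: diag_def matrix_matrix_mult_def if_distrib[of "\<lambda>x. x * _"] cong: if_cong)

lemma system_matrix_vector_component:
  "(system_matrix \<alpha> P *v z) $ i = z $ i - (1 - \<alpha> $ i) * (\<Sum>j\<in>UNIV. P $ i $ j * z $ j)"
proof -
  have "system_matrix \<alpha> P *v z = z - (P *v z - (diag \<alpha> ** P) *v z)"
    by (simp add: system_matrix_def matrix_vector_mult_diff_rdistrib matrix_vector_mul_assoc[symmetric])
  then have "(system_matrix \<alpha> P *v z) $ i = z $ i - ((P *v z) $ i - ((diag \<alpha> ** P) *v z) $ i)"
    by simp
  moreover have "((diag \<alpha> ** P) *v z) $ i = \<alpha> $ i * (P *v z) $ i"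
    by (simp add: matrix_vector_mult_def diag_mult_component sum_distrib_left mult.assoc)
  moreover have "(P *v z) $ i = (\<Sum>j\<in>UNIV. P $ i $ j * z $ j)"
    by (simp add: matrix_vector_mult_def)
  ultimately show ?thesis
    by (simp add: algebra_simps)
qed

text \<open>Row \<open>i\<close> of \<open>P\<close> averages the coordinates of \<open>z\<close>,
  so the average is at most \<open>\<bar>z $ i\<bar>\<close> in absolute value. The reverse triangle
  inequality then leaves
  \<open>\<bar>z $ i\<bar> - (1 - \<alpha> $ i) * \<bar>z $ i\<bar>\<close>.\<close>

lemma system_matrix_max_component:
  fixes z :: "real ^ 'n"
  assumes P: "row_stochastic P" and a: "\<And>i. 0 < \<alpha> $ i \<and> \<alpha> $ i < 1"
  obtains i where "\<And>k. \<bar>z $ k\<bar> \<le> \<bar>z $ i\<bar>" "\<alpha> $ i * \<bar>z $ i\<bar> \<le> \<bar>(system_matrix \<alpha> P *v z) $ i\<bar>"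
proof -
  obtain i where i: "\<And>k. \<bar>z $ k\<bar> \<le> \<bar>z $ i\<bar>"
  proof -
    have "Max (range (\<lambda>k. \<bar>z $ k\<bar>)) \<in> range (\<lambda>k. \<bar>z $ k\<bar>)"
      by (rule Max_in) auto
    then obtain i where "Max (range (\<lambda>k. \<bar>z $ k\<bar>)) = \<bar>z $ i\<bar>"
      by blast
    then have "\<bar>z $ k\<bar> \<le> \<bar>z $ i\<bar>" for k
      by (metis Max_ge finite_imageI finite rangeI)
    then show ?thesis using that by blast
  qed
  have nn: "0 \<le> P $ i $ j" for j
    using P by (simp add: row_stochastic_def)
  have "\<bar>\<Sum>j\<in>UNIV. P $ i $ j * z $ j\<bar> \<le> (\<Sum>j\<in>UNIV. P $ i $ j * \<bar>z $ i\<bar>)"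
    by (rule order_trans[OF sum_abs], rule sum_mono) (simp add: abs_mult nn i mult_left_mono)
  also have "\<dots> = \<bar>z $ i\<bar>"
    by (simp add: sum_distrib_right[symmetric] row_sum_stochastic[OF P])
  finally have "\<bar>(1 - \<alpha> $ i) * (\<Sum>j\<in>UNIV. P $ i $ j * z $ j)\<bar> \<le> (1 - \<alpha> $ i) * \<bar>z $ i\<bar>"
    using a[of i] by (simp add: abs_mult)
  then have "\<alpha> $ i * \<bar>z $ i\<bar> \<le> \<bar>(system_matrix \<alpha> P *v z) $ i\<bar>"
    unfolding system_matrix_vector_component by (simp add: algebra_simps)
  with i show ?thesis using that by blast
qed

text \<open>For a kernel vector the largest coordinate must vanish, because
  \<open>\<alpha> $ i\<close> is positive; and a square matrix with trivial kernel is
  invertible.\<close>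

lemma invertible_system_matrix:
  assumes "row_stochastic P" and "\<And>i. 0 < \<alpha> $ i \<and> \<alpha> $ i < 1"
  shows "invertible (system_matrix \<alpha> P)"
proof -
  have "z = 0" if "system_matrix \<alpha> P *v z = 0" for z
  proof -
    obtain i where i: "\<And>k. \<bar>z $ k\<bar> \<le> \<bar>z $ i\<bar>" "\<alpha> $ i * \<bar>z $ i\<bar> \<le> \<bar>(system_matrix \<alpha> P *v z) $ i\<bar>"
      using system_matrix_max_component[OF assms] by blast
    then have "z $ i = 0"
      using that assms(2)[of i] by (simp add: mult_le_0_iff)
    then show ?thesis
      using i(1) by (simp add: vec_eq_iff)
  qed
  then show ?thesis
    by (metis invertible_left_inverse matrix_left_invertible_ker)
qed

lemma matrix_inv_inverse:
  fixes M :: "'a::semiring_1 ^ 'n ^ 'm"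
  assumes "invertible M"
  shows "M ** matrix_inv M = mat 1" and "matrix_inv M ** M = mat 1"
  using someI_ex[OF assms[unfolded invertible_def]] by (simp_all add: matrix_inv_def)

lemma system_matrix_opinion_matrix:
  assumes "invertible (system_matrix \<alpha> P)"
  shows "system_matrix \<alpha> P *v (opinion_matrix \<alpha> P *v y) = y"
  using matrix_inv_inverse(1)[OF assms]
  by (simp add: opinion_matrix_def matrix_vector_mul_assoc)

text \<open>Allows a formula for the inverse to be verified by applying the system matrix to
  it.\<close>

lemma opinion_matrix_eqI:
  assumes "invertible (system_matrix \<alpha> P)" and "system_matrix \<alpha> P *v z = y"
  shows "opinion_matrix \<alpha> P *v y = z"
  using matrix_inv_inverse(2)[OF assms(1)] assms(2)
  by (auto simp: opinion_matrix_def matrix_vector_mul_assoc)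

text \<open>The bound does not mention \<open>P\<close>; this gives the uniformity in the
  perturbation coefficient.\<close>

lemma opinion_matrix_component_le:
  fixes y :: "real ^ 'n"
  assumes "row_stochastic P" and a: "\<And>i. 0 < \<alpha> $ i \<and> \<alpha> $ i < 1"
  shows "\<bar>(opinion_matrix \<alpha> P *v y) $ k\<bar> \<le> norm y / Min (range (($) \<alpha>))"
proof -
  let ?z = "opinion_matrix \<alpha> P *v y" and ?m = "Min (range (($) \<alpha>))"
  obtain i where i: "\<And>k. \<bar>?z $ k\<bar> \<le> \<bar>?z $ i\<bar>"
      "\<alpha> $ i * \<bar>?z $ i\<bar> \<le> \<bar>(system_matrix \<alpha> P *v ?z) $ i\<bar>"
    using system_matrix_max_component[OF assms] by blast
  \<comment> \<open>The maximizing index \<open>i\<close> depends on \<open>P\<close> and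
    \<open>y\<close>; the minimum over the finitely many users replaces \<open>\<alpha> $ i\<close>
    by a fixed positive constant.\<close>
  have m: "0 < ?m" "?m \<le> \<alpha> $ i"
    using a by auto
  have "?m * \<bar>?z $ k\<bar> \<le> \<alpha> $ i * \<bar>?z $ i\<bar>"
    using i(1) m order_trans[OF less_imp_le[OF m(1)] m(2)] by (intro mult_mono) simp_all
  also have "\<dots> \<le> \<bar>y $ i\<bar>"
    using i(2) by (simp add: system_matrix_opinion_matrix invertible_system_matrix assms)
  also have "\<dots> \<le> norm y"
    by (rule component_le_norm_cart)
  finally show ?thesis
    using m by (simp add: field_simps)
qed

lemma Delta_W_component:
  "Delta_W Att Tgt W $ i $ j =
     of_bool (j \<in> attackers_of Att Tgt i) - real (card (attackers_of Att Tgt i)) * W $ i $ j"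
proof -
  let ?T = "all_targets Att Tgt" and ?A = "attackers_of Att Tgt"
  have "outer (axis v 1) (\<Sum>u\<in>S. axis u 1) $ i $ j = (if v = i then of_bool (j \<in> S) else 0)"
    for v and S :: "'a set"
    by (simp add: outer_def axis_def)
  moreover have "(outer (axis v 1) (axis v 1) ** W) $ i $ j = (if v = i then W $ i $ j else 0)" for v
    by (auto simp: outer_def matrix_matrix_mult_def axis_def if_distrib[of "\<lambda>x. x * _"] cong: if_cong)
  ultimately have "Delta_W Att Tgt W $ i $ j
      = (\<Sum>v\<in>?T. if v = i then of_bool (j \<in> ?A v) else 0)
        - (\<Sum>v\<in>?T. if v = i then real (card (?A v)) * W $ i $ j else 0)"
    by (simp add: Delta_W_def if_distrib[of "\<lambda>x. _ * x"] cong: if_cong)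
  \<comment> \<open>In a row that is not targeted both sums vanish, and so does the claimed
    formula.\<close>
  moreover have "?A i = {}" if "i \<notin> ?T"
    using that by (auto simp: attackers_of_def all_targets_def)
  ultimately show ?thesis
    by (cases "i \<in> ?T") simp_all
qed

text \<open>Row \<open>i\<close> keeps the fraction \<open>1 - ?c * p\<close> of its old weights and
  gives \<open>p\<close> to each of its \<open>?c\<close> attackers. Admissibility makes both parts
  nonnegative, and the rows of \<open>Delta_W\<close> sum to zero.\<close>

lemma row_stochastic_perturbed:
  assumes W: "row_stochastic W" and p: "p \<in> admissible_coeffs Att Tgt"
  shows "row_stochastic (perturbed Att Tgt W p)"
  unfolding row_stochastic_def
proof (intro conjI allI)
  fix i j
  let ?c = "real (card (attackers_of Att Tgt i))"
  have eq: "perturbed Att Tgt W p $ i $ j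
      = (1 - ?c * p) * W $ i $ j + p * of_bool (j \<in> attackers_of Att Tgt i)"
    by (simp add: perturbed_def Delta_W_component algebra_simps)
  have "?c * p \<le> 1"
  proof (cases "i \<in> all_targets Att Tgt")
    case True
    then show ?thesis using p by (simp add: admissible_coeffs_def)
  next
    case False
    then have "attackers_of Att Tgt i = {}"
      by (auto simp: attackers_of_def all_targets_def)
    then show ?thesis by simp
  qed
  then show "0 \<le> perturbed Att Tgt W p $ i $ j"
    unfolding eq using W p by (simp add: row_stochastic_def admissible_coeffs_def)
next
  have "(\<Sum>j\<in>UNIV. perturbed Att Tgt W p $ i $ j) = 1" for i
    by (simp add: perturbed_def Delta_W_component sum.distrib sum_subtractf
        sum_distrib_left[symmetric] row_sum_stochastic[OF W])
  then show "perturbed Att Tgt W p *v ones = ones"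
    by (simp add: vec_eq_iff matrix_vector_mult_def ones_def)
qed

lemma system_matrix_perturbed:
  "system_matrix \<alpha> (perturbed Att Tgt W p) *v z
     = system_matrix \<alpha> W *v z - p *\<^sub>R (((mat 1 - diag \<alpha>) ** Delta_W Att Tgt W) *v z)"
  by (simp add: system_matrix_def perturbed_def matrix_vector_mul_assoc[symmetric]
      matrix_vector_mult_diff_rdistrib matrix_vector_mult_add_rdistrib matrix_vector_right_distrib
      matrix_vector_mult_scaleR scaleR_matrix_vector_assoc[symmetric] algebra_simps)

text \<open>An exact identity, not only an asymptotic one. Applying the perturbed system matrix to
  the right-hand side makes the terms in \<open>p\<close> and in \<open>p\<^sup>2\<close> cancel in
  pairs, leaving \<open>y\<close>.\<close>

lemma opinion_matrix_perturbed_expansion: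
  fixes W :: "real ^ 'n ^ 'n" and \<alpha> y :: "real ^ 'n" and Att :: "'n set" and Tgt :: "'n \<Rightarrow> 'n set"
    and p :: real
  defines "D \<equiv> (mat 1 - diag \<alpha>) ** Delta_W Att Tgt W" and "B \<equiv> opinion_matrix \<alpha> W"
    and "Bp \<equiv> opinion_matrix \<alpha> (perturbed Att Tgt W p)"
  assumes "invertible (system_matrix \<alpha> W)"
    and inv': "invertible (system_matrix \<alpha> (perturbed Att Tgt W p))"
  shows "Bp *v y = B *v y + p *\<^sub>R ((B ** D ** B) *v y) + p\<^sup>2 *\<^sub>R (Bp *v ((D ** B ** D ** B) *v y))"
  unfolding Bp_def
proof (rule opinion_matrix_eqI[OF inv'], fold Bp_def)
  let ?M = "system_matrix \<alpha> (perturbed Att Tgt W p)"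
  have MB: "?M *v (B *v x) = x - p *\<^sub>R (D *v (B *v x))" for x
    using assms(4) by (simp add: system_matrix_perturbed system_matrix_opinion_matrix D_def B_def)
  have MBp: "?M *v (Bp *v x) = x" for x
    using inv' by (simp add: system_matrix_opinion_matrix Bp_def)
  show "?M *v (B *v y + p *\<^sub>R ((B ** D ** B) *v y) + p\<^sup>2 *\<^sub>R (Bp *v ((D ** B ** D ** B) *v y))) = y"
    by (simp add: matrix_vector_right_distrib matrix_vector_mult_scaleR MB MBp
        matrix_vector_mul_assoc[symmetric] scaleR_diff_right power2_eq_square)
qed

theorem proposition1:
  fixes W :: "real ^ 'n ^ 'n" and \<alpha> s :: "real ^ 'n"
    and Att :: "'n set" and Tgt :: "'n \<Rightarrow> 'n set"
  assumes W_nonneg: "\<And>i j. 0 \<le> W $ i $ j"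
    and W_stoch: "W *v ones = ones"
    and stubborn: "\<And>i. 0 < \<alpha> $ i \<and> \<alpha> $ i < 1"
  shows "invertible (system_matrix \<alpha> W)
    \<and> (\<forall>p \<in> admissible_coeffs Att Tgt. invertible (system_matrix \<alpha> (perturbed Att Tgt W p)))
    \<and> (\<lambda>p. total_opinion \<alpha> s (perturbed Att Tgt W p)
          - (ones \<bullet> ((opinion_matrix \<alpha> W ** diag \<alpha>) *v s)
             + p * (ones \<bullet> ((opinion_matrix \<alpha> W ** (mat 1 - diag \<alpha>) ** Delta_W Att Tgt W
                               ** opinion_matrix \<alpha> W ** diag \<alpha>) *v s))))
        \<in> O[at 0 within admissible_coeffs Att Tgt](\<lambda>p. p\<^sup>2)"
proof -
  have W: "row_stochastic W"
    using W_nonneg W_stoch by (simp add: row_stochastic_def)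
  have inv: "invertible (system_matrix \<alpha> W)"
    by (rule invertible_system_matrix[OF W stubborn])
  have inv': "invertible (system_matrix \<alpha> (perturbed Att Tgt W p))"
    if "p \<in> admissible_coeffs Att Tgt" for p
    by (rule invertible_system_matrix[OF row_stochastic_perturbed[OF W that] stubborn])
  define D where "D = (mat 1 - diag \<alpha>) ** Delta_W Att Tgt W"
  define B where "B = opinion_matrix \<alpha> W"
  define Bp where "Bp p = opinion_matrix \<alpha> (perturbed Att Tgt W p)" for p
  \<comment> \<open>The part of the remainder that is independent of \<open>p\<close>; only the
    factor \<open>Bp p\<close> in front of it varies.\<close>
  define r where "r = (D ** B ** D ** B) *v (diag \<alpha> *v s)"
  \<comment> \<open>Pairing with \<open>ones\<close> adds up \<open>CARD('n)\<close> coordinates,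
    each bounded by the quotient.\<close>
  define C where "C = real CARD('n) * (norm r / Min (range (($) \<alpha>)))"
  let ?err = "\<lambda>p. total_opinion \<alpha> s (perturbed Att Tgt W p)
          - (ones \<bullet> ((opinion_matrix \<alpha> W ** diag \<alpha>) *v s)
             + p * (ones \<bullet> ((opinion_matrix \<alpha> W ** (mat 1 - diag \<alpha>) ** Delta_W Att Tgt W
                               ** opinion_matrix \<alpha> W ** diag \<alpha>) *v s)))"
  have "norm (?err p) \<le> C * norm (p\<^sup>2)" if p: "p \<in> admissible_coeffs Att Tgt" for p
  proof -
    have "?err p = p\<^sup>2 * (ones \<bullet> (Bp p *v r))"
      using opinion_matrix_perturbed_expansion[OF inv inv'[OF p], of "diag \<alpha> *v s"]
      by (simp add: total_opinion_def B_def Bp_def D_def r_def inner_add_right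
          matrix_vector_mul_assoc matrix_mul_assoc)
    moreover have "\<bar>ones \<bullet> (Bp p *v r)\<bar> \<le> C"
    proof -
      have "\<bar>ones \<bullet> (Bp p *v r)\<bar> \<le> (\<Sum>k\<in>UNIV. \<bar>(Bp p *v r) $ k\<bar>)"
        by (simp add: inner_vec_def ones_def sum_abs)
      also have "\<dots> \<le> (\<Sum>k\<in>(UNIV::'n set). norm r / Min (range (($) \<alpha>)))"
        unfolding Bp_def
        by (intro sum_mono opinion_matrix_component_le row_stochastic_perturbed W p stubborn)
      finally show ?thesis by (simp add: C_def)
    qed
    ultimately show ?thesis
      by (simp add: abs_mult mult.commute[of C] mult_left_mono)
  qed
  \<comment> \<open>The estimate holds at every admissible \<open>p\<close>, hence eventually along
    the filter, with no restriction to a neighbourhood of 0.\<close>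
  then have "?err \<in> O[at 0 within admissible_coeffs Att Tgt](\<lambda>p. p\<^sup>2)"
    by (intro bigoI[of _ C]) (auto simp: eventually_at_filter)
  with inv inv' show ?thesis by blast
qed

end
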